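(* Let $M$ be a compact metric space and $f:M\to M$ a continuous map. Then $o(f)=0$ if and only if $f$ is Lyapunov stable. In addition, if $f$ is a homeomorphism and there exists $x\in M$ such that $x\notin\alpha(x)$, then $o(f)\ge[n]$.
   Context: Orders of growth. Let $\mathbb{N}=\{1,2,\dots\}$ and let $\mathcal{O}$ be the set of non-decreasing sequences $a:\mathbb{N}\to[0,\infty)$. For $a_1,a_2\in\mathcal{O}$ write $a_1\approx a_2$ if there are $c,C\in(0,\infty)$ with $c\,a_1(n)\le a_2(n)\le C\,a_1(n)$ for all $n$. Let $\mathbb{O}=\mathcal{O}/{\approx}$, and let $[a(n)]\in\mathbb{O}$ denote the class of $a$; e.g. $[n]$ is the class of the sequence $a(n)=n$. Partially order $\mathbb{O}$ by: $[a_1(n)]\le[a_2(n)]$ iff there is $C>0$ with $a_1(n)\le C\,a_2(n)$ for all $n$. Let $\overline{\mathbb{O}}$ be the Dedekind–MacNeille completion of $(\mathbb{O},\le)$ (the smallest complete lattice containing $\mathbb{O}$), so $\mathbb{O}\subset\overline{\mathbb{O}}$. The symbol $0\in\mathbb{O}$ denotes the class of the constant sequence $a(n)=1$. Generalized topological entropy. For a compact metric space $(M,d)$ and a continuous map $f:M\to M$, put $d_n(x,y)=\max\{d(f^i(x),f^i(y)):0\le i\le n\}$ and $B(x,n,\epsilon)=\{y\in M:d_n(x,y)\le\epsilon\}$. Let $g_{f,\epsilon}(n)$ be the minimal cardinality of a finite set $E\subset M$ with $M=\bigcup_{x\in E}B(x,n,\epsilon)$. Then $g_{f,\epsilon}\in\mathcal{O}$,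 and $o(f)=\sup\{[g_{f,\epsilon}(n)]:\epsilon>0\}\in\overline{\mathbb{O}}$. $f$ is Lyapunov stable if for every $\epsilon>0$ there is $\delta>0$ such that $d(x,y)<\delta$ implies $d(f^n(x),f^n(y))<\epsilon$ for all $n\in\mathbb{N}$. For a homeomorphism $f$, $\alpha(x)$ is the $\alpha$-limit set of $x$: the set of limits of sequences $f^{-n_k}(x)$ with $n_k\to+\infty$. *)

theory Defs
  imports "HOL-Analysis.Analysis"
begin

section \<open>Orders of growth\<close>

text \<open>Sequences are indexed by the positive integers. They are represented by functions on
  \<^typ>\<open>nat\<close> whose value at \<open>0\<close> is ignored by every definition below.\<close>

definition growth_seq :: "(nat \<Rightarrow> real) \<Rightarrow> bool" where
  "growth_seq a \<longleftrightarrow> (\<forall>n\<ge>1. 0 \<le> a n) \<and> mono_on {1..} a"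

definition growth_eq :: "(nat \<Rightarrow> real) \<Rightarrow> (nat \<Rightarrow> real) \<Rightarrow> bool" where
  "growth_eq a b \<longleftrightarrow> growth_seq a \<and> growth_seq b \<and>
     (\<exists>c>0. \<exists>C>0. \<forall>n\<ge>1. c * a n \<le> b n \<and> b n \<le> C * a n)"

definition growth_le :: "(nat \<Rightarrow> real) \<Rightarrow> (nat \<Rightarrow> real) \<Rightarrow> bool" where
  "growth_le a b \<longleftrightarrow> (\<exists>C>0. \<forall>n\<ge>1. a n \<le> C * b n)"

lemma growth_le_refl: "growth_le a a"
  unfolding growth_le_def by (rule exI[of _ 1]) simp

lemma growth_le_trans:
  assumes "growth_le a b" "growth_le b c" shows "growth_le a c"
proof -
  obtain C D where C: "C > 0" "\<forall>n\<ge>1. a n \<le> C * b n" and D: "D > 0" "\<forall>n\<ge>1. b n \<le> D * c n"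
    using assms unfolding growth_le_def by blast
  have "a n \<le> (C * D) * c n" if "n \<ge> 1" for n
  proof -
    have "a n \<le> C * b n" using C that by blast
    also have "\<dots> \<le> C * (D * c n)" using C D that by (intro mult_left_mono) auto
    finally show ?thesis by (simp add: mult.assoc)
  qed
  then show ?thesis using C D unfolding growth_le_def by (intro exI[of _ "C * D"]) simp
qed

lemma growth_eq_iff_le:
  "growth_eq a b \<longleftrightarrow> growth_seq a \<and> growth_seq b \<and> growth_le a b \<and> growth_le b a"
proof -
  have "(\<exists>c>0. \<forall>n\<ge>1. c * a n \<le> b n) \<longleftrightarrow> growth_le a b"
  proof
    assume "\<exists>c>0. \<forall>n\<ge>1. c * a n \<le> b n"
    then obtain c where "c > 0" "\<forall>n\<ge>1. c * a n \<le> b n" by blast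
    then show "growth_le a b" unfolding growth_le_def
      by (intro exI[of _ "1 / c"]) (auto simp: field_simps)
  next
    assume "growth_le a b"
    then obtain C where "C > 0" "\<forall>n\<ge>1. a n \<le> C * b n" unfolding growth_le_def by blast
    then show "\<exists>c>0. \<forall>n\<ge>1. c * a n \<le> b n"
      by (intro exI[of _ "1 / C"]) (auto simp: field_simps)
  qed
  then show ?thesis unfolding growth_eq_def growth_le_def by blast
qed

lemma growth_seq_const: "c \<ge> 0 \<Longrightarrow> growth_seq (\<lambda>_. c)"
  by (simp add: growth_seq_def mono_on_def)

lemma growth_seq_of_nat: "growth_seq real"
  by (simp add: growth_seq_def mono_on_def)

quotient_type growth = "nat \<Rightarrow> real" / partial: growth_eq
  morphisms rep_growth growth_class
proof (rule part_equivpI)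
  show "\<exists>a. growth_eq a a"
    using growth_seq_const[of 1] growth_le_refl by (auto simp: growth_eq_iff_le)
  show "symp growth_eq" by (auto simp: symp_def growth_eq_iff_le)
  show "transp growth_eq"
    unfolding transp_def growth_eq_iff_le by (blast intro: growth_le_trans)
qed

instantiation growth :: order
begin

lift_definition less_eq_growth :: "growth \<Rightarrow> growth \<Rightarrow> bool" is growth_le
  unfolding growth_eq_iff_le by (blast intro: growth_le_trans)

definition less_growth :: "growth \<Rightarrow> growth \<Rightarrow> bool" where
  "less_growth a b \<longleftrightarrow> a \<le> b \<and> \<not> b \<le> a"

instance
proof
  fix a b c :: growth
  show "(a < b) = (a \<le> b \<and> \<not> b \<le> a)" by (simp add: less_growth_def)
  show "a \<le> a" by transfer (rule growth_le_refl)
  show "a \<le> c" if "a \<le> b" "b \<le> c" using that by transfer (rule growth_le_trans)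
  show "a = b" if "a \<le> b" "b \<le> a" using that by transfer (auto simp: growth_eq_iff_le)
qed

end

lemma growth_class_le_iff:
  assumes "growth_seq a" "growth_seq b"
  shows "growth_class a \<le> growth_class b \<longleftrightarrow> (\<exists>C>0. \<forall>n\<ge>1. a n \<le> C * b n)"
proof -
  have "growth_eq a a" "growth_eq b b"
    using assms by (auto simp: growth_eq_iff_le growth_le_refl)
  then show ?thesis by (simp add: less_eq_growth.abs_eq growth_le_def)
qed

lemma growth_class_eq_iff:
  assumes "growth_seq a" "growth_seq b"
  shows "growth_class a = growth_class b \<longleftrightarrow> growth_eq a b"
  using assms growth_class_le_iff[of a b] growth_class_le_iff[of b a]
  by (auto simp: growth_eq_iff_le growth_le_def order.eq_iff)


section \<open>Dedekind--MacNeille completion\<close>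

definition upper_bounds :: "'a::order set \<Rightarrow> 'a set" where
  "upper_bounds A = {b. \<forall>a\<in>A. a \<le> b}"

definition lower_bounds :: "'a::order set \<Rightarrow> 'a set" where
  "lower_bounds A = {b. \<forall>a\<in>A. b \<le> a}"

lemma upper_lower_galois: "A \<subseteq> lower_bounds B \<longleftrightarrow> B \<subseteq> upper_bounds A"
  by (auto simp: upper_bounds_def lower_bounds_def)

lemma subset_lower_upper: "A \<subseteq> lower_bounds (upper_bounds A)"
  by (simp add: upper_lower_galois)

lemma lower_upper_mono:
  "A \<subseteq> B \<Longrightarrow> lower_bounds (upper_bounds A) \<subseteq> lower_bounds (upper_bounds B)"
  by (auto simp: upper_bounds_def lower_bounds_def)

lemma lower_upper_lower [simp]: "lower_bounds (upper_bounds (lower_bounds A)) = lower_bounds A"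
  by (auto simp: upper_bounds_def lower_bounds_def)

lemma lower_upper_atMost [simp]: "lower_bounds (upper_bounds {..x}) = {..x}"
  by (auto simp: upper_bounds_def lower_bounds_def)

text \<open>The elements of the completion are the cuts, represented by their lower parts.\<close>

typedef (overloaded) 'a::order dm_completion = "{A :: 'a set. lower_bounds (upper_bounds A) = A}"
  morphisms cut_of Abs_dm_completion
  by (rule exI[of _ "lower_bounds {}"]) simp

setup_lifting type_definition_dm_completion

instantiation dm_completion :: (order) complete_lattice
begin

lift_definition less_eq_dm_completion :: "'a dm_completion \<Rightarrow> 'a dm_completion \<Rightarrow> bool" is "(\<subseteq>)" .

lift_definition less_dm_completion :: "'a dm_completion \<Rightarrow> 'a dm_completion \<Rightarrow> bool" is "(\<subset>)" .

lift_definition Inf_dm_completion :: "'a dm_completion set \<Rightarrow> 'a dm_completion" is Inter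
proof -
  fix S :: "'a set set"
  assume S: "\<And>A. A \<in> S \<Longrightarrow> lower_bounds (upper_bounds A) = A"
  have "lower_bounds (upper_bounds (\<Inter>S)) \<subseteq> A" if "A \<in> S" for A
    using lower_upper_mono[of "\<Inter>S" A] S[OF that] that by blast
  then show "lower_bounds (upper_bounds (\<Inter>S)) = \<Inter>S"
    using subset_lower_upper[of "\<Inter>S"] by blast
qed

lift_definition Sup_dm_completion :: "'a dm_completion set \<Rightarrow> 'a dm_completion"
  is "\<lambda>S. lower_bounds (upper_bounds (\<Union>S))" by simp

lift_definition inf_dm_completion ::
  "'a dm_completion \<Rightarrow> 'a dm_completion \<Rightarrow> 'a dm_completion" is "(\<inter>)"
proof -
  fix A B :: "'a set"
  assume "lower_bounds (upper_bounds A) = A" "lower_bounds (upper_bounds B) = B"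
  then show "lower_bounds (upper_bounds (A \<inter> B)) = A \<inter> B"
    using lower_upper_mono[of "A \<inter> B" A] lower_upper_mono[of "A \<inter> B" B]
      subset_lower_upper[of "A \<inter> B"] by blast
qed

lift_definition sup_dm_completion ::
  "'a dm_completion \<Rightarrow> 'a dm_completion \<Rightarrow> 'a dm_completion"
  is "\<lambda>A B. lower_bounds (upper_bounds (A \<union> B))" by simp

lift_definition bot_dm_completion :: "'a dm_completion" is "lower_bounds UNIV" by simp

lift_definition top_dm_completion :: "'a dm_completion" is UNIV
  using subset_lower_upper by blast

instance
proof
  fix x y z :: "'a dm_completion" and S :: "'a dm_completion set"
  have closed: "lower_bounds (upper_bounds B) \<subseteq> A"
    if "B \<subseteq> A" "lower_bounds (upper_bounds A) = A" for A B :: "'a set"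
    using lower_upper_mono[OF that(1)] that(2) by simp
  show "(x < y) = (x \<le> y \<and> \<not> y \<le> x)" by transfer auto
  show "x \<le> x" by transfer simp
  show "x \<le> z" if "x \<le> y" "y \<le> z" using that by transfer simp
  show "x = y" if "x \<le> y" "y \<le> x" using that by transfer simp
  show "inf x y \<le> x" "inf x y \<le> y" by (transfer, simp)+
  show "x \<le> inf y z" if "x \<le> y" "x \<le> z" using that by transfer simp
  show "x \<le> sup x y" by transfer (use subset_lower_upper in blast)
  show "y \<le> sup x y" by transfer (use subset_lower_upper in blast)
  show "sup y z \<le> x" if "y \<le> x" "z \<le> x" using that by transfer (simp add: closed)
  show "Inf S \<le> x" if "x \<in> S"
    using that by (auto simp: less_eq_dm_completion.rep_eq Inf_dm_completion.rep_eq)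
  show "z \<le> Inf S" if "\<And>x. x \<in> S \<Longrightarrow> z \<le> x"
    using that by (auto simp: less_eq_dm_completion.rep_eq Inf_dm_completion.rep_eq)
  show "x \<le> Sup S" if "x \<in> S"
    unfolding less_eq_dm_completion.rep_eq Sup_dm_completion.rep_eq
    using that by (intro order_trans[OF _ subset_lower_upper]) auto
  show "Sup S \<le> z" if "\<And>x. x \<in> S \<Longrightarrow> x \<le> z"
    unfolding less_eq_dm_completion.rep_eq Sup_dm_completion.rep_eq
  proof (rule closed)
    show "\<Union> (cut_of ` S) \<subseteq> cut_of z"
      using that by (auto simp: less_eq_dm_completion.rep_eq)
    show "lower_bounds (upper_bounds (cut_of z)) = cut_of z" using cut_of[of z] by simp
  qed
  show "Inf {} = (top :: 'a dm_completion)" by transfer simp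
  show "Sup {} = (bot :: 'a dm_completion)"
    by transfer (simp add: upper_bounds_def)
qed

end

lift_definition dm_embed :: "'a::order \<Rightarrow> 'a dm_completion" is "\<lambda>x. {..x}" by simp

lemma dm_embed_le_iff [simp]: "dm_embed x \<le> dm_embed y \<longleftrightarrow> x \<le> y"
  by transfer simp

lemma dm_embed_eq_iff [simp]: "dm_embed x = dm_embed y \<longleftrightarrow> x = y"
  by (simp add: order.eq_iff)

text \<open>The image of the embedding is join-dense and meet-dense, which characterizes the
  completion up to isomorphism.\<close>

lemma dm_embed_le_iff_mem: "dm_embed x \<le> X \<longleftrightarrow> x \<in> cut_of X"
proof transfer
  fix x :: 'a and A :: "'a set"
  assume A: "lower_bounds (upper_bounds A) = A"
  have "y \<in> A" if "x \<in> A" "y \<le> x" for y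
  proof -
    have "x \<in> lower_bounds (upper_bounds A)" using that(1) A by simp
    then have "y \<in> lower_bounds (upper_bounds A)"
      using that(2) order_trans[of y x] by (auto simp: lower_bounds_def)
    then show ?thesis using A by simp
  qed
  then show "{..x} \<subseteq> A \<longleftrightarrow> x \<in> A" by auto
qed

lemma le_dm_embed_iff: "X \<le> dm_embed x \<longleftrightarrow> x \<in> upper_bounds (cut_of X)"
  by transfer (auto simp: upper_bounds_def)

lemma dm_completion_leI: "(\<And>x. x \<in> cut_of X \<Longrightarrow> x \<in> cut_of Y) \<Longrightarrow> X \<le> Y"
  unfolding less_eq_dm_completion.rep_eq by blast

lemma dm_join_dense: "X = Sup {dm_embed x |x. dm_embed x \<le> X}"
proof (rule antisym)
  show "X \<le> Sup {dm_embed x |x. dm_embed x \<le> X}" (is "_ \<le> ?S")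
  proof -
    have "x \<in> cut_of ?S" if "x \<in> cut_of X" for x
      using that unfolding dm_embed_le_iff_mem[symmetric] by (intro Sup_upper CollectI exI[of _ x] conjI refl)
    then show ?thesis by (rule dm_completion_leI)
  qed
qed (rule Sup_least, auto)

lemma dm_meet_dense: "X = Inf {dm_embed x |x. X \<le> dm_embed x}"
proof (rule antisym)
  show "Inf {dm_embed x |x. X \<le> dm_embed x} \<le> X" (is "?I \<le> _")
  proof -
    have "y \<in> cut_of X" if "y \<in> cut_of ?I" for y
    proof -
      have "dm_embed y \<le> dm_embed x" if "X \<le> dm_embed x" for x
      proof (rule order_trans)
        show "dm_embed y \<le> ?I" using \<open>y \<in> cut_of ?I\<close> by (simp add: dm_embed_le_iff_mem)
        show "?I \<le> dm_embed x"
          using that by (intro Inf_lower CollectI exI[of _ x] conjI refl)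
      qed
      then have "y \<in> lower_bounds (upper_bounds (cut_of X))"
        by (simp add: lower_bounds_def le_dm_embed_iff[symmetric])
      then show ?thesis using cut_of[of X] by simp
    qed
    then show ?thesis by (rule dm_completion_leI)
  qed
qed (rule Inf_greatest, auto)


section \<open>Generalized topological entropy\<close>

text \<open>The metric space is a set \<open>M\<close> with the metric of the ambient type, and \<open>f\<close> is a
  self-map of \<open>M\<close>; its values outside \<open>M\<close> play no role.\<close>

definition bowen_dist :: "('a::metric_space \<Rightarrow> 'a) \<Rightarrow> nat \<Rightarrow> 'a \<Rightarrow> 'a \<Rightarrow> real" where
  "bowen_dist f n x y = Max ((\<lambda>i. dist ((f ^^ i) x) ((f ^^ i) y)) ` {0..n})"

definition bowen_cball ::
  "'a::metric_space set \<Rightarrow> ('a \<Rightarrow> 'a) \<Rightarrow> 'a \<Rightarrow> nat \<Rightarrow> real \<Rightarrow> 'a set" where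
  "bowen_cball M f x n \<epsilon> = {y \<in> M. bowen_dist f n x y \<le> \<epsilon>}"

definition covering_number ::
  "'a::metric_space set \<Rightarrow> ('a \<Rightarrow> 'a) \<Rightarrow> real \<Rightarrow> nat \<Rightarrow> nat" where
  "covering_number M f \<epsilon> n =
     (LEAST k. \<exists>E\<subseteq>M. finite E \<and> card E = k \<and> M = (\<Union>x\<in>E. bowen_cball M f x n \<epsilon>))"

definition entropy_order ::
  "'a::metric_space set \<Rightarrow> ('a \<Rightarrow> 'a) \<Rightarrow> growth dm_completion" where
  "entropy_order M f =
     Sup {dm_embed (growth_class (\<lambda>n. real (covering_number M f \<epsilon> n))) |\<epsilon>. \<epsilon> > 0}"

lemma bowen_dist_le_iff:
  "bowen_dist f n x y \<le> \<epsilon> \<longleftrightarrow> (\<forall>i\<le>n. dist ((f ^^ i) x) ((f ^^ i) y) \<le> \<epsilon>)"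
  unfolding bowen_dist_def by (subst Max_le_iff) auto

lemma continuous_on_funpow_self:
  assumes "continuous_on M f" "f \<in> M \<rightarrow> M"
  shows "continuous_on M (f ^^ i) \<and> (f ^^ i) ` M \<subseteq> M"
proof (induction i)
  case (Suc i)
  have "continuous_on M (f \<circ> (f ^^ i))"
    using Suc assms(1) by (blast intro: continuous_on_compose continuous_on_subset)
  then show ?case using Suc assms(2) by auto
qed (simp add: continuous_on_id)

lemma finite_bowen_cover:
  assumes M: "compact M" and f: "continuous_on M f" "f \<in> M \<rightarrow> M" and \<epsilon>: "\<epsilon> > 0"
  shows "\<exists>E\<subseteq>M. finite E \<and> M = (\<Union>x\<in>E. bowen_cball M f x n \<epsilon>)"
proof -
  have "\<exists>\<delta>>0. \<forall>x\<in>M. \<forall>y\<in>M. dist y x < \<delta> \<longrightarrow> dist ((f ^^ i) y) ((f ^^ i) x) < \<epsilon>" for i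
    using compact_uniformly_continuous[OF _ M, of "f ^^ i"] continuous_on_funpow_self[OF f] \<epsilon>
    unfolding uniformly_continuous_on_def by blast
  then obtain \<delta> where \<delta>: "\<And>i. \<delta> i > 0"
    "\<And>i x y. x \<in> M \<Longrightarrow> y \<in> M \<Longrightarrow> dist y x < \<delta> i \<Longrightarrow> dist ((f ^^ i) y) ((f ^^ i) x) < \<epsilon>"
    by metis
  define r where "r = Min (\<delta> ` {..n})"
  have r: "r > 0" "\<And>i. i \<le> n \<Longrightarrow> r \<le> \<delta> i"
    unfolding r_def using \<delta>(1) by auto
  obtain E where E: "E \<subseteq> M" "finite E" "M \<subseteq> (\<Union>x\<in>E. ball x r)"
    using compactE_image[OF M, of M "\<lambda>x. ball x r"] r by force
  have "bowen_dist f n x y \<le> \<epsilon>" if "x \<in> E" "y \<in> M" "dist x y < r" for x y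
    unfolding bowen_dist_le_iff
    using \<delta>(2)[of y x] r(2) that E(1) by (meson less_eq_real_def less_le_trans subset_iff)
  then have "M = (\<Union>x\<in>E. bowen_cball M f x n \<epsilon>)"
    using E unfolding bowen_cball_def by (auto simp: subset_iff) (metis)
  then show ?thesis using E by blast
qed

text \<open>Covering numbers form an order of growth, so the classes in \<^const>\<open>entropy_order\<close>
  are well defined.\<close>

lemma growth_seq_covering_number:
  assumes M: "compact M" and f: "continuous_on M f" "f \<in> M \<rightarrow> M" and \<epsilon>: "\<epsilon> > 0"
  shows "growth_seq (\<lambda>n. real (covering_number M f \<epsilon> n))"
proof -
  have "covering_number M f \<epsilon> m \<le> covering_number M f \<epsilon> n" if "m \<le> n" for m n
  proof -
    let ?P = "\<lambda>n k. \<exists>E\<subseteq>M. finite E \<and> card E = k \<and> M = (\<Union>x\<in>E. bowen_cball M f x n \<epsilon>)"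
    have "\<exists>k. ?P n k" using finite_bowen_cover[OF assms, of n] by blast
    then have "?P n (covering_number M f \<epsilon> n)"
      unfolding covering_number_def by (rule LeastI_ex)
    then obtain E where E: "E \<subseteq> M" "finite E" "card E = covering_number M f \<epsilon> n"
      "M = (\<Union>x\<in>E. bowen_cball M f x n \<epsilon>)" by blast
    have "bowen_cball M f x n \<epsilon> \<subseteq> bowen_cball M f x m \<epsilon>" for x
      using that unfolding bowen_cball_def bowen_dist_le_iff by auto
    moreover have "bowen_cball M f x m \<epsilon> \<subseteq> M" for x
      unfolding bowen_cball_def by blast
    moreover have "M \<subseteq> (\<Union>x\<in>E. bowen_cball M f x n \<epsilon>)" using E(4) by (rule equalityD1)
    ultimately have "M = (\<Union>x\<in>E. bowen_cball M f x m \<epsilon>)"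
      by (intro equalityI UN_least) (auto dest!: subsetD)
    then have "?P m (covering_number M f \<epsilon> n)" using E(1-3) by (intro exI[of _ E] conjI)
    then show ?thesis unfolding covering_number_def[of M f \<epsilon> m] by (rule Least_le)
  qed
  then show ?thesis by (simp add: growth_seq_def mono_on_def)
qed


section \<open>Dynamical notions\<close>

definition lyapunov_stable :: "'a::metric_space set \<Rightarrow> ('a \<Rightarrow> 'a) \<Rightarrow> bool" where
  "lyapunov_stable M f \<longleftrightarrow>
     (\<forall>\<epsilon>>0. \<exists>\<delta>>0. \<forall>x\<in>M. \<forall>y\<in>M. dist x y < \<delta> \<longrightarrow>
        (\<forall>n\<ge>1. dist ((f ^^ n) x) ((f ^^ n) y) < \<epsilon>))"

definition alpha_limit :: "'a::metric_space set \<Rightarrow> ('a \<Rightarrow> 'a) \<Rightarrow> 'a \<Rightarrow> 'a set" where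
  "alpha_limit M f x =
     {y. \<exists>\<nu> :: nat \<Rightarrow> nat. filterlim \<nu> at_top sequentially \<and>
           (\<lambda>k. (inv_into M f ^^ \<nu> k) x) \<longlonglongrightarrow> y}"

end

theory Submission imports Defs begin

text \<open>
  Everything rests on comparing covers with separated sets: two points whose orbits are
  more than \<open>2 * \<epsilon>\<close> apart at some time up to \<open>n\<close> cannot lie in one Bowen ball of radius \<open>\<epsilon>\<close>,
  so the covering number is at least the size of every separated set
  (\<open>card_separated_le_covering_number\<close>).

  As \<open>M\<close> is nonempty, \<open>o(f) = 0\<close> says that for each \<open>\<epsilon>\<close> the covering numbers are bounded in
  \<open>n\<close>.  If \<open>f\<close> is Lyapunov stable, a finite cover by small metric balls is a Bowen cover for
  all \<open>n\<close> simultaneously.  Conversely, bounded covering numbers bound the size of sets that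
  are separated at arbitrary times, so a largest such set \<open>S\<close> exists, and by maximality the
  whole orbit of every point is shadowed by that of a point of \<open>S\<close>.  The points shadowed by a
  given \<open>s \<in> S\<close> form a closed set, and \<open>M\<close> is a finite union of these sets.  Points close
  enough to \<open>y\<close> avoid those of the closed sets that miss \<open>y\<close>, hence share one of them with
  \<open>y\<close> and stay near \<open>y\<close> forever; compactness makes this uniform.

  For the linear lower bound, if \<open>x \<notin> \<alpha>(x)\<close> then the backward orbit of \<open>x\<close> never returns
  to some ball around \<open>x\<close>.  For \<open>i < j\<close> the map \<open>f\<^sup>i\<close> sends the \<open>i\<close>-th point of the backward
  orbit to \<open>x\<close> and the \<open>j\<close>-th to another point of the backward orbit, so its first \<open>n + 1\<close>
  points are separated within time \<open>n\<close>.
\<close>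

section \<open>Covers and separated sets\<close>

lemma covering_number_le_card:
  assumes "E \<subseteq> M" "finite E" "M \<subseteq> (\<Union>x\<in>E. bowen_cball M f x n \<epsilon>)"
  shows "covering_number M f \<epsilon> n \<le> card E"
proof -
  have "(\<Union>x\<in>E. bowen_cball M f x n \<epsilon>) \<subseteq> M"
    by (auto simp: bowen_cball_def)
  with assms(3) have "M = (\<Union>x\<in>E. bowen_cball M f x n \<epsilon>)" by (rule subset_antisym)
  with assms(1,2) show ?thesis
    unfolding covering_number_def by (intro Least_le exI[of _ E] conjI refl)
qed

lemma card_separated_le_covering_number:
  assumes M: "compact M" and f: "continuous_on M f" "f \<in> M \<rightarrow> M" and \<epsilon>: "\<epsilon> > 0"
    and S: "S \<subseteq> M"
    and sep: "\<And>x y. x \<in> S \<Longrightarrow> y \<in> S \<Longrightarrow> x \<noteq> y \<Longrightarrow>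
                \<exists>i\<le>n. dist ((f ^^ i) x) ((f ^^ i) y) > 2 * \<epsilon>"
  shows "card S \<le> covering_number M f \<epsilon> n"
proof -
  have "\<exists>k. \<exists>E\<subseteq>M. finite E \<and> card E = k \<and> M = (\<Union>x\<in>E. bowen_cball M f x n \<epsilon>)"
    using finite_bowen_cover[OF M f \<epsilon>, of n] by blast
  from LeastI_ex[OF this] obtain E where E: "finite E" "card E = covering_number M f \<epsilon> n"
    "M = (\<Union>x\<in>E. bowen_cball M f x n \<epsilon>)"
    unfolding covering_number_def by blast
  have "\<forall>y\<in>S. \<exists>c. c \<in> E \<and> y \<in> bowen_cball M f c n \<epsilon>"
    using subset_trans[OF S equalityD1[OF E(3)]] by blast
  then obtain c where c: "\<And>y. y \<in> S \<Longrightarrow> c y \<in> E" "\<And>y. y \<in> S \<Longrightarrow> y \<in> bowen_cball M f (c y) n \<epsilon>"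
    by metis
  have "inj_on c S"
  proof (rule inj_onI, rule ccontr)
    fix x y assume xy: "x \<in> S" "y \<in> S" "c x = c y" "x \<noteq> y"
    then obtain i where i: "i \<le> n" "dist ((f ^^ i) x) ((f ^^ i) y) > 2 * \<epsilon>"
      using sep by blast
    have "dist ((f ^^ i) (c x)) ((f ^^ i) x) \<le> \<epsilon>" "dist ((f ^^ i) (c x)) ((f ^^ i) y) \<le> \<epsilon>"
      using c(2)[OF xy(1)] c(2)[OF xy(2)] xy(3) i(1)
      by (auto simp: bowen_cball_def bowen_dist_le_iff)
    then show False
      using dist_triangle3[of "(f ^^ i) x" "(f ^^ i) y" "(f ^^ i) (c x)"] i(2) by linarith
  qed
  moreover have "c ` S \<subseteq> E" using c(1) by blast
  ultimately show ?thesis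
    using card_inj_on_le[of c S E] E(1,2) by simp
qed

text \<open>A finite set that is separated at unrestricted times is separated up to some finite time,
  so a bound on the covering numbers that is uniform in \<open>n\<close> applies to it.\<close>

lemma card_orbit_separated_le:
  assumes M: "compact M" and f: "continuous_on M f" "f \<in> M \<rightarrow> M" and \<epsilon>: "\<epsilon> > 0"
    and bound: "\<And>n. n \<ge> 1 \<Longrightarrow> covering_number M f \<epsilon> n \<le> K"
    and S: "S \<subseteq> M" "finite S"
    and sep: "pairwise (\<lambda>x y. \<exists>i. dist ((f ^^ i) x) ((f ^^ i) y) > 2 * \<epsilon>) S"
  shows "card S \<le> K"
proof -
  obtain t where t: "\<And>x y. x \<in> S \<Longrightarrow> y \<in> S \<Longrightarrow> x \<noteq> y \<Longrightarrow>
      dist ((f ^^ t x y) x) ((f ^^ t x y) y) > 2 * \<epsilon>"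
    using sep unfolding pairwise_def by metis
  define n where "n = Max (insert 1 ((\<lambda>(x, y). t x y) ` (S \<times> S)))"
  have n: "t x y \<le> n" if "x \<in> S" "y \<in> S" for x y
    using that S(2) unfolding n_def by (auto intro!: Max_ge)
  have "n \<ge> 1" using S(2) unfolding n_def by (auto intro!: Max_ge)
  have "card S \<le> covering_number M f \<epsilon> n"
    using t n by (intro card_separated_le_covering_number[OF M f \<epsilon> S(1)]) blast
  also have "\<dots> \<le> K" using bound \<open>n \<ge> 1\<close> .
  finally show ?thesis .
qed

section \<open>Bounded covering numbers and Lyapunov stability\<close>

lemma lyapunov_stable_imp_covering_number_bounded:
  assumes M: "compact M" and stable: "lyapunov_stable M f" and \<epsilon>: "\<epsilon> > 0"
  shows "\<exists>K. \<forall>n. covering_number M f \<epsilon> n \<le> K"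
proof -
  obtain \<delta> where \<delta>: "\<delta> > 0" "\<And>x y n. x \<in> M \<Longrightarrow> y \<in> M \<Longrightarrow> dist x y < \<delta> \<Longrightarrow> n \<ge> 1 \<Longrightarrow>
      dist ((f ^^ n) x) ((f ^^ n) y) < \<epsilon>"
    using stable \<epsilon> unfolding lyapunov_stable_def by blast
  \<comment> \<open>Stability says nothing about time 0, so the balls must themselves have radius at most \<open>\<epsilon>\<close>.\<close>
  define r where "r = min \<delta> \<epsilon>"
  obtain E where E: "E \<subseteq> M" "finite E" "M \<subseteq> (\<Union>x\<in>E. ball x r)"
    using compactE_image[OF M, of M "\<lambda>x. ball x r"] \<delta>(1) \<epsilon> by (force simp: r_def)
  have "bowen_dist f n x y \<le> \<epsilon>" if "x \<in> E" "y \<in> M" "dist x y < r" for n x y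
    unfolding bowen_dist_le_iff
  proof (intro allI impI)
    fix i
    show "dist ((f ^^ i) x) ((f ^^ i) y) \<le> \<epsilon>"
    proof (cases "i = 0")
      case False
      then show ?thesis using \<delta>(2)[of x y i] that E(1) by (auto simp: r_def)
    qed (use that in \<open>simp add: r_def\<close>)
  qed
  then have "M \<subseteq> (\<Union>x\<in>E. bowen_cball M f x n \<epsilon>)" for n
    using E(3) unfolding bowen_cball_def by fastforce
  then show ?thesis using covering_number_le_card[OF E(1,2)] by blast
qed

lemma closed_shadowed:
  assumes "compact M" "continuous_on M f" "f \<in> M \<rightarrow> M"
  shows "closed {y \<in> M. \<forall>i. dist ((f ^^ i) s) ((f ^^ i) y) \<le> r}"
proof -
  have "closed {y \<in> M. dist ((f ^^ i) s) ((f ^^ i) y) \<le> r}" for i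
    using assms continuous_on_funpow_self[of M f i]
    by (intro continuous_on_closed_Collect_le continuous_intros) (auto simp: compact_imp_closed)
  then have "closed (M \<inter> (\<Inter>i. {y \<in> M. dist ((f ^^ i) s) ((f ^^ i) y) \<le> r}))"
    using compact_imp_closed[OF assms(1)] by (intro closed_Int closed_INT) auto
  moreover have "M \<inter> (\<Inter>i. {y \<in> M. dist ((f ^^ i) s) ((f ^^ i) y) \<le> r})
      = {y \<in> M. \<forall>i. dist ((f ^^ i) s) ((f ^^ i) y) \<le> r}"
    by auto
  ultimately show ?thesis by simp
qed

text \<open>A largest orbit-separated set shadows every point: a point it fails to shadow could be
  added to it.\<close>

lemma finite_shadowing_set:
  assumes M: "compact M" and f: "continuous_on M f" "f \<in> M \<rightarrow> M" and \<epsilon>: "\<epsilon> > 0"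
    and bound: "\<And>n. n \<ge> 1 \<Longrightarrow> covering_number M f \<epsilon> n \<le> K"
  obtains S where "S \<subseteq> M" "finite S"
    "\<And>y. y \<in> M \<Longrightarrow> \<exists>s\<in>S. \<forall>i. dist ((f ^^ i) s) ((f ^^ i) y) \<le> 2 * \<epsilon>"
proof -
  define apart where "apart x y \<longleftrightarrow> (\<exists>i. dist ((f ^^ i) x) ((f ^^ i) y) > 2 * \<epsilon>)" for x y
  define P where "P S \<longleftrightarrow> S \<subseteq> M \<and> finite S \<and> pairwise apart S" for S
  have "P {}" by (simp add: P_def)
  moreover have "card S < Suc K" if "P S" for S
    using card_orbit_separated_le[OF M f \<epsilon> bound, of S] that
    by (auto simp: P_def apart_def[abs_def])
  ultimately obtain S where S: "P S" and max: "\<And>T. P T \<Longrightarrow> card T \<le> card S"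
    using ex_has_greatest_nat[of P "{}" card "Suc K"] by blast
  have "\<exists>s\<in>S. \<not> apart s y" if y: "y \<in> M" for y
  proof (rule ccontr)
    assume far: "\<not> (\<exists>s\<in>S. \<not> apart s y)"
    have "\<not> apart y y" using \<epsilon> by (simp add: apart_def)
    with far have "y \<notin> S" by blast
    have "apart s y \<longleftrightarrow> apart y s" for s by (simp add: apart_def dist_commute)
    then have "P (insert y S)" using S far y by (auto simp: P_def pairwise_insert)
    from max[OF this] \<open>y \<notin> S\<close> S show False by (simp add: P_def)
  qed
  then show ?thesis using that[of S] S by (auto simp: P_def apart_def not_less)
qed

lemma covering_number_bounded_imp_lyapunov_stable:
  assumes M: "compact M" and f: "continuous_on M f" "f \<in> M \<rightarrow> M"
    and bound: "\<And>\<epsilon>. \<epsilon> > 0 \<Longrightarrow> \<exists>K. \<forall>n\<ge>1. covering_number M f \<epsilon> n \<le> K"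
  shows "lyapunov_stable M f"
  unfolding lyapunov_stable_def
proof (intro allI impI)
  fix e :: real assume "e > 0"
  \<comment> \<open>Two close points are compared through a third point \<open>y\<close>, and each of them with \<open>y\<close>
      through a point shadowing both at distance \<open>2 * \<epsilon>\<close>: this gives \<open>8 * \<epsilon> < e\<close>.\<close>
  define \<epsilon> where "\<epsilon> = e / 9"
  have \<epsilon>: "\<epsilon> > 0" using \<open>e > 0\<close> by (simp add: \<epsilon>_def)
  obtain K where K: "\<And>n. n \<ge> 1 \<Longrightarrow> covering_number M f \<epsilon> n \<le> K" using bound[OF \<epsilon>] by blast
  obtain S where S: "finite S"
    "\<And>y. y \<in> M \<Longrightarrow> \<exists>s\<in>S. \<forall>i. dist ((f ^^ i) s) ((f ^^ i) y) \<le> 2 * \<epsilon>"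
    using finite_shadowing_set[OF M f \<epsilon> K] by metis
  define A where "A s = {y \<in> M. \<forall>i. dist ((f ^^ i) s) ((f ^^ i) y) \<le> 2 * \<epsilon>}" for s
  define U where "U y = - (\<Union>s\<in>{s\<in>S. y \<notin> A s}. A s)" for y
  have near: "dist ((f ^^ i) y) ((f ^^ i) z) \<le> 4 * \<epsilon>" if "z \<in> M" "z \<in> U y" for y z i
  proof -
    obtain s where s: "s \<in> S" "z \<in> A s" using S(2)[OF \<open>z \<in> M\<close>] \<open>z \<in> M\<close> by (auto simp: A_def)
    with that have "y \<in> A s" by (auto simp: U_def)
    with s have "dist ((f ^^ i) s) ((f ^^ i) y) \<le> 2 * \<epsilon>" "dist ((f ^^ i) s) ((f ^^ i) z) \<le> 2 * \<epsilon>"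
      by (auto simp: A_def)
    then show ?thesis
      using dist_triangle3[of "(f ^^ i) y" "(f ^^ i) z" "(f ^^ i) s"] by linarith
  qed
  have "closed (A s)" for s unfolding A_def by (rule closed_shadowed[OF M f])
  then have "open (U y)" for y
    unfolding U_def using S(1) by (intro open_Compl closed_UN) auto
  moreover have "M \<subseteq> \<Union> (range U)" by (auto simp: U_def)
  ultimately obtain \<delta> where \<delta>: "\<delta> > 0" "\<And>x. x \<in> M \<Longrightarrow> \<exists>G\<in>range U. ball x \<delta> \<subseteq> G"
    using Heine_Borel_lemma[OF M, of "range U"] by (metis rangeE)
  have "dist ((f ^^ n) x) ((f ^^ n) z) < e" if "x \<in> M" "z \<in> M" "dist x z < \<delta>" for x z n
  proof -
    obtain y where "ball x \<delta> \<subseteq> U y" using \<delta>(2)[OF \<open>x \<in> M\<close>] by blast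
    with that \<delta>(1) have "x \<in> U y" "z \<in> U y" by auto
    then have "dist ((f ^^ n) y) ((f ^^ n) x) \<le> 4 * \<epsilon>" "dist ((f ^^ n) y) ((f ^^ n) z) \<le> 4 * \<epsilon>"
      using near that by auto
    then show ?thesis
      using dist_triangle3[of "(f ^^ n) x" "(f ^^ n) z" "(f ^^ n) y"] \<epsilon> unfolding \<epsilon>_def by linarith
  qed
  then show "\<exists>\<delta>>0. \<forall>x\<in>M. \<forall>z\<in>M. dist x z < \<delta> \<longrightarrow> (\<forall>n\<ge>1. dist ((f ^^ n) x) ((f ^^ n) z) < e)"
    using \<delta>(1) by blast
qed

text \<open>Covers of a nonempty space are nonempty, so \<open>o(f)\<close> is always at least the class
  of the constants, and only the upper bound carries information.\<close>

lemma entropy_order_eq_const_iff_bounded: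
  assumes M: "compact M" "M \<noteq> {}" and f: "continuous_on M f" "f \<in> M \<rightarrow> M"
  shows "entropy_order M f = dm_embed (growth_class (\<lambda>n. 1)) \<longleftrightarrow>
    (\<forall>\<epsilon>>0. \<exists>K. \<forall>n\<ge>1. covering_number M f \<epsilon> n \<le> K)" (is "?o = ?z \<longleftrightarrow> ?B")
proof -
  define g where "g \<epsilon> = growth_class (\<lambda>n. real (covering_number M f \<epsilon> n))" for \<epsilon>
  have o: "?o = Sup {dm_embed (g \<epsilon>) |\<epsilon>. \<epsilon> > 0}" by (simp add: entropy_order_def g_def)
  note seq = growth_seq_covering_number[OF M(1) f]
  have one: "growth_seq (\<lambda>n. 1)" by (rule growth_seq_const) simp
  have g_le: "g \<epsilon> \<le> growth_class (\<lambda>n. 1) \<longleftrightarrow> (\<exists>K. \<forall>n\<ge>1. covering_number M f \<epsilon> n \<le> K)"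
    if "\<epsilon> > 0" for \<epsilon>
    unfolding g_def growth_class_le_iff[OF seq[OF that] one]
  proof
    assume "\<exists>C>0. \<forall>n\<ge>1. real (covering_number M f \<epsilon> n) \<le> C * 1"
    then obtain C where "\<forall>n\<ge>1. real (covering_number M f \<epsilon> n) \<le> C" by auto
    then have "\<forall>n\<ge>1. covering_number M f \<epsilon> n \<le> nat \<lfloor>C\<rfloor>" by (simp add: le_nat_floor)
    then show "\<exists>K. \<forall>n\<ge>1. covering_number M f \<epsilon> n \<le> K" by blast
  next
    assume "\<exists>K. \<forall>n\<ge>1. covering_number M f \<epsilon> n \<le> K"
    then obtain K where "\<forall>n\<ge>1. covering_number M f \<epsilon> n \<le> K" by blast
    then show "\<exists>C>0. \<forall>n\<ge>1. real (covering_number M f \<epsilon> n) \<le> C * 1"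
      by (intro exI[of _ "real K + 1"]) (auto intro: add_increasing2)
  qed
  have "?z \<le> ?o"
  proof -
    obtain x where "x \<in> M" using M(2) by blast
    then have "1 \<le> covering_number M f 1 n" for n
      using card_separated_le_covering_number[OF M(1) f, of 1 "{x}" n] by simp
    then have "growth_class (\<lambda>n. 1) \<le> g 1"
      unfolding g_def by (subst growth_class_le_iff[OF one seq]) (auto intro!: exI[of _ 1])
    then have "?z \<le> dm_embed (g 1)" by simp
    also have "\<dots> \<le> ?o" unfolding o by (rule Sup_upper) (auto intro: exI[of _ 1])
    finally show ?thesis .
  qed
  then have "?o = ?z \<longleftrightarrow> ?o \<le> ?z" by auto
  also have "\<dots> \<longleftrightarrow> (\<forall>\<epsilon>>0. g \<epsilon> \<le> growth_class (\<lambda>n. 1))"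
    unfolding o Sup_le_iff by auto
  finally show ?thesis using g_le by simp
qed

section \<open>Linear growth from a point outside its alpha-limit set\<close>

text \<open>Far back, the backward orbit avoids a ball around \<open>x\<close> because \<open>x \<notin> \<alpha>(x)\<close>; and none of
  its remaining finitely many points is \<open>x\<close> itself, as a periodic point is its own
  \<open>\<alpha>\<close>-limit.\<close>

lemma backward_orbit_avoids_ball:
  assumes "x \<notin> alpha_limit M f x"
  obtains r where "r > 0" "\<And>k. k \<ge> 1 \<Longrightarrow> dist x ((inv_into M f ^^ k) x) > r"
proof -
  define h where "h = inv_into M f"
  have nonper: "(h ^^ k) x \<noteq> x" if "k \<ge> 1" for k
  proof
    assume per: "(h ^^ k) x = x"
    have "(h ^^ (k * m)) x = x" for m
      by (induction m) (simp_all add: funpow_add per)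
    moreover have "filterlim (\<lambda>m. k * m) at_top sequentially"
      using that by (intro filterlim_subseq) (simp add: strict_mono_def)
    ultimately have "x \<in> alpha_limit M f x"
      unfolding alpha_limit_def h_def[symmetric] by (auto intro!: exI[of _ "\<lambda>m. k * m"])
    with assms show False ..
  qed
  have "\<exists>N. \<exists>r>0. \<forall>k\<ge>N. dist x ((h ^^ k) x) > r"
  proof (rule ccontr)
    assume "\<not> ?thesis"
    then have "\<forall>m. \<exists>k\<ge>m. dist x ((h ^^ k) x) \<le> inverse (real (Suc m))"
      by (metis inverse_positive_iff_positive not_less of_nat_0_less_iff zero_less_Suc)
    then obtain \<nu> where \<nu>: "\<And>m. \<nu> m \<ge> m" "\<And>m. dist x ((h ^^ \<nu> m) x) \<le> inverse (real (Suc m))"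
      by metis
    have "filterlim \<nu> at_top sequentially"
      using \<nu>(1) by (intro filterlim_at_top_mono[OF filterlim_ident]) auto
    moreover have "(\<lambda>m. (h ^^ \<nu> m) x) \<longlonglongrightarrow> x"
      unfolding tendsto_dist_iff[of _ x]
      by (rule tendsto_sandwich[OF _ _ tendsto_const LIMSEQ_inverse_real_of_nat])
         (use \<nu>(2) in \<open>auto simp: dist_commute\<close>)
    ultimately have "x \<in> alpha_limit M f x"
      unfolding alpha_limit_def h_def[symmetric] by blast
    with assms show False ..
  qed
  then obtain N r where r: "r > 0" "\<And>k. k \<ge> N \<Longrightarrow> dist x ((h ^^ k) x) > r" by blast
  define D where "D = insert r ((\<lambda>k. dist x ((h ^^ k) x)) ` {1..<N})"
  have D: "finite D" "D \<noteq> {}" by (simp_all add: D_def)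
  have "Min D > 0"
    unfolding Min_gr_iff[OF D] using r(1) nonper by (auto simp: D_def dest: sym)
  moreover have "dist x ((h ^^ k) x) > Min D / 2" if "k \<ge> 1" for k
  proof -
    have "Min D \<le> dist x ((h ^^ k) x)"
    proof (cases "k < N")
      case True
      then show ?thesis using that D by (intro Min_le) (auto simp: D_def)
    next
      case False
      have "Min D \<le> r" using D by (intro Min_le) (auto simp: D_def)
      with r(2)[of k] False show ?thesis by simp
    qed
    with \<open>Min D > 0\<close> show ?thesis by linarith
  qed
  ultimately show ?thesis using that[of "Min D / 2"] by (simp add: h_def)
qed

lemma covering_number_ge_of_notin_alpha_limit:
  assumes M: "compact M" and f: "continuous_on M f" "f ` M = M"
    and x: "x \<in> M" "x \<notin> alpha_limit M f x"
  shows "\<exists>\<epsilon>>0. \<forall>n. n + 1 \<le> covering_number M f \<epsilon> n"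
proof -
  define h where "h = inv_into M f"
  obtain r where r: "r > 0" "\<And>k. k \<ge> 1 \<Longrightarrow> dist x ((h ^^ k) x) > r"
    using backward_orbit_avoids_ball[OF x(2)] unfolding h_def by blast
  define p where "p j = (h ^^ j) x" for j
  have p_M: "p j \<in> M" for j
    by (induction j) (use x f in \<open>auto simp: p_def h_def inv_into_into\<close>)
  have forward: "(f ^^ i) (p j) = p (j - i)" if "i \<le> j" for i j
    using that
  proof (induction i)
    case (Suc i)
    then obtain m where m: "j - i = Suc m" "j - Suc i = m"
      by (metis Suc_diff_Suc Suc_le_lessD)
    have "f (p (Suc m)) = p m"
      using f_inv_into_f[of "p m" f M] p_M[of m] f(2) by (simp add: p_def h_def)
    with Suc m show ?case by simp
  qed simp
  have sep: "dist ((f ^^ i) (p i)) ((f ^^ i) (p j)) > r" if "i < j" for i j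
    using r(2)[of "j - i"] that forward[of i i] forward[of i j] by (simp add: p_def)
  have inj: "inj p"
  proof (rule linorder_injI)
    fix i j :: nat assume "i < j"
    from sep[OF this] r(1) show "p i \<noteq> p j" by auto
  qed
  have "n + 1 \<le> covering_number M f (r / 2) n" for n
  proof -
    have "card (p ` {..n}) \<le> covering_number M f (r / 2) n"
    proof (rule card_separated_le_covering_number[OF M f(1)])
      fix a b assume ab: "a \<in> p ` {..n}" "b \<in> p ` {..n}" "a \<noteq> b"
      then obtain i j where ij: "a = p i" "b = p j" "i \<le> n" "j \<le> n" "i \<noteq> j" by blast
      then show "\<exists>i\<le>n. 2 * (r / 2) < dist ((f ^^ i) a) ((f ^^ i) b)"
        using sep[of i j] sep[of j i] by (auto simp: neq_iff dist_commute)
    qed (use f p_M r(1) in auto)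
    moreover have "card (p ` {..n}) = n + 1"
      using inj by (simp add: card_image inj_on_subset)
    ultimately show ?thesis by simp
  qed
  then show ?thesis using r(1) by (intro exI[of _ "r / 2"]) simp
qed

theorem theorem3:
  fixes M :: "'a::metric_space set" and f :: "'a \<Rightarrow> 'a"
  assumes "compact M" and "M \<noteq> {}"
    and "continuous_on M f" and "f \<in> M \<rightarrow> M"
  shows "(entropy_order M f = dm_embed (growth_class (\<lambda>n. 1)) \<longleftrightarrow> lyapunov_stable M f) \<and>
    ((\<exists>g. homeomorphism M M f g) \<and> (\<exists>x\<in>M. x \<notin> alpha_limit M f x)
      \<longrightarrow> entropy_order M f \<ge> dm_embed (growth_class (\<lambda>n. real n)))"
proof (intro conjI impI)
  show "entropy_order M f = dm_embed (growth_class (\<lambda>n. 1)) \<longleftrightarrow> lyapunov_stable M f"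
    unfolding entropy_order_eq_const_iff_bounded[OF assms]
    using covering_number_bounded_imp_lyapunov_stable[OF assms(1,3,4)]
      lyapunov_stable_imp_covering_number_bounded[OF assms(1)] by blast
next
  assume "(\<exists>g. homeomorphism M M f g) \<and> (\<exists>x\<in>M. x \<notin> alpha_limit M f x)"
  then obtain x where "f ` M = M" "x \<in> M" "x \<notin> alpha_limit M f x"
    by (auto simp: homeomorphism_def)
  from covering_number_ge_of_notin_alpha_limit[OF assms(1,3) this]
  obtain \<epsilon> where \<epsilon>: "\<epsilon> > 0" "\<And>n. n + 1 \<le> covering_number M f \<epsilon> n" by blast
  have "real n \<le> 1 * real (covering_number M f \<epsilon> n)" for n
    using \<epsilon>(2)[of n] by simp
  then have "growth_class (\<lambda>n. real n) \<le> growth_class (\<lambda>n. real (covering_number M f \<epsilon> n))"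
    using growth_class_le_iff[OF growth_seq_of_nat growth_seq_covering_number[OF assms(1,3,4) \<epsilon>(1)]]
    by (metis zero_less_one)
  then have "dm_embed (growth_class (\<lambda>n. real n))
      \<le> dm_embed (growth_class (\<lambda>n. real (covering_number M f \<epsilon> n)))"
    by simp
  also have "\<dots> \<le> entropy_order M f"
    unfolding entropy_order_def using \<epsilon>(1) by (intro Sup_upper) blast
  finally show "entropy_order M f \<ge> dm_embed (growth_class (\<lambda>n. real n))" .
qed

end
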